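(* For any connected graph $G$, $f(G)\ge fc(G)$.
   Context: Equality problem on a graph: let $G=(V,E)$ be a connected undirected graph. On each vertex of $G$ sits a player holding an $n$-bit string. Players may communicate only with their neighbours in $G$ (sending bits along edges), according to a fixed deterministic communication protocol, and at the end the players must decide, correctly for every input, whether all their input strings are equal. The cost of a protocol is the total number of bits transmitted (over all edges, in the worst case over inputs). Let $f(n,G)$ denote the minimum cost of a protocol solving this problem on $G$ for $n$-bit inputs, and let $f(G)=\lim_{n\to\infty} f(n,G)/n$ (this limit exists by subadditivity). Cuts: a cut of $G$ is a pair $(S,\overline{S})$ with $\emptyset\ne S\subsetneq V$ and $\overline{S}=V\setminus S$ (with $(S,\overline S)$ and $(\overline S,S)$ identified); its edges are the edges of $G$ with one endpoint in $S$ and one in $\overline S$. Let $\mathcal S$ be the set of all cuts of $G$ and, for an edge $e$, let $\mathcal S_e$ be the set of cuts containing $e$. A fractional packing of cuts is a function $g:\mathcal S\to[0,1]$ with $\sum_{(S,\overline S)\in\mathcal S_e} g(S,\overline S)\le 1$ for every edge $e$. $fc(G)$ is the maximum of $\sum_{(S,\overline S)\in\mathcal S} g(S,\overline S)$ over all fractional packings of cuts $g$. *)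

theory Defs
  imports "HOL-Analysis.Analysis" "HOL-Library.Extended_Nat"
begin

text \<open>A finite simple undirected graph: vertex set \<open>V\<close> and a set \<open>E\<close> of two-element subsets
  of \<open>V\<close>.\<close>

definition simple_graph :: "'a set \<Rightarrow> 'a set set \<Rightarrow> bool" where
  "simple_graph V E \<longleftrightarrow>
     finite V \<and> V \<noteq> {} \<and> (\<forall>e\<in>E. \<exists>u\<in>V. \<exists>v\<in>V. u \<noteq> v \<and> e = {u, v})"

definition connected_graph :: "'a set \<Rightarrow> 'a set set \<Rightarrow> bool" where
  "connected_graph V E \<longleftrightarrow>
     simple_graph V E \<and> (\<forall>u\<in>V. \<forall>v\<in>V. (u, v) \<in> {(a, b). {a, b} \<in> E}\<^sup>*)"


subsection \<open>Cuts and fractional packings of cuts\<close>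

text \<open>A cut is the unordered pair \<open>{S, V - S}\<close>, so that the two orderings of the sides are
  identified.\<close>

definition graph_cuts :: "'a set \<Rightarrow> 'a set set set" where
  "graph_cuts V = {{S, V - S} | S. S \<noteq> {} \<and> S \<subset> V}"

definition cuts_containing :: "'a set \<Rightarrow> 'a set \<Rightarrow> 'a set set set" where
  "cuts_containing V e =
     {C \<in> graph_cuts V. \<exists>S u v. C = {S, V - S} \<and> e = {u, v} \<and> u \<in> S \<and> v \<in> V - S}"

definition fractional_cut_packing :: "'a set \<Rightarrow> 'a set set \<Rightarrow> ('a set set \<Rightarrow> real) \<Rightarrow> bool" where
  "fractional_cut_packing V E g \<longleftrightarrow>
     (\<forall>C\<in>graph_cuts V. g C \<in> {0..1}) \<and> (\<forall>e\<in>E. (\<Sum>C\<in>cuts_containing V e. g C) \<le> 1)"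

text \<open>The supremum of a linear functional over a nonempty compact polytope, hence a maximum.\<close>

definition fc :: "'a set \<Rightarrow> 'a set set \<Rightarrow> real" where
  "fc V E = Sup {\<Sum>C\<in>graph_cuts V. g C | g. fractional_cut_packing V E g}"


subsection \<open>Deterministic communication protocols on a graph\<close>

text \<open>
  Communication is asynchronous and private. Every edge \<open>{u, v}\<close> carries two FIFO channels, one
  in each direction. The next action of a player is a function of that player's own input and of
  the bits the player has sent and received so far: send a bit to a neighbour, wait for the next
  bit from a specified neighbour, or stop with a decision. Hence neither silence nor the passage of
  time nor the global order of events conveys information; information is carried only by
  transmitted bits, which are what the cost counts. The pattern of communication may depend on the
  inputs.
\<close>

datatype 'a action = Send 'a bool | Receive 'a | Decide bool

datatype 'a event = Sent 'a bool | Received 'a bool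

type_synonym 'a protocol = "'a \<Rightarrow> bool list \<Rightarrow> 'a event list \<Rightarrow> 'a action"

text \<open>A configuration is given by the local histories of the players (oldest event first). The
  bits in transit from \<open>w\<close> to \<open>v\<close> are those sent by \<open>w\<close> to \<open>v\<close> beyond the ones \<open>v\<close> has received.\<close>

type_synonym 'a config = "'a \<Rightarrow> 'a event list"

definition sent_to :: "'a \<Rightarrow> 'a event list \<Rightarrow> bool list" where
  "sent_to v h = [b. Sent w b \<leftarrow> h, w = v]"

definition received_from :: "'a \<Rightarrow> 'a event list \<Rightarrow> bool list" where
  "received_from w h = [b. Received u b \<leftarrow> h, u = w]"

inductive step :: "'a set \<Rightarrow> 'a set set \<Rightarrow> 'a protocol \<Rightarrow> ('a \<Rightarrow> bool list) \<Rightarrow>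
    'a config \<Rightarrow> 'a config \<Rightarrow> bool"
  for V :: "'a set" and E :: "'a set set" and P :: "'a protocol" and x :: "'a \<Rightarrow> bool list" where
  send: "\<lbrakk>v \<in> V; {v, w} \<in> E; P v (x v) (H v) = Send w b\<rbrakk>
    \<Longrightarrow> step V E P x H (H(v := H v @ [Sent w b]))"
| receive: "\<lbrakk>v \<in> V; {v, w} \<in> E; P v (x v) (H v) = Receive w;
      sent_to v (H w) = received_from w (H v) @ b # bs\<rbrakk>
    \<Longrightarrow> step V E P x H (H(v := H v @ [Received w b]))"

definition reachable :: "'a set \<Rightarrow> 'a set set \<Rightarrow> 'a protocol \<Rightarrow> ('a \<Rightarrow> bool list) \<Rightarrow>
    'a config set" where
  "reachable V E P x = {H. (step V E P x)\<^sup>*\<^sup>* (\<lambda>_. []) H}"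

definition bits_sent :: "'a set \<Rightarrow> 'a config \<Rightarrow> nat" where
  "bits_sent V H = (\<Sum>v\<in>V. length [b. Sent w b \<leftarrow> H v])"

definition inputs :: "'a set \<Rightarrow> nat \<Rightarrow> ('a \<Rightarrow> bool list) set" where
  "inputs V n = {x. \<forall>v\<in>V. length (x v) = n}"

text \<open>Every execution that cannot be continued has ended properly: all players have stopped with
  the correct answer and no bit is left in transit. (Infinite executions are excluded by
  finiteness of the cost below, since no more bits can be received than are sent.)\<close>

definition decides_equality :: "'a set \<Rightarrow> 'a set set \<Rightarrow> nat \<Rightarrow> 'a protocol \<Rightarrow> bool" where
  "decides_equality V E n P \<longleftrightarrow>
     (\<forall>x\<in>inputs V n. \<forall>H\<in>reachable V E P x. (\<nexists>H'. step V E P x H H') \<longrightarrow>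
        (\<forall>v\<in>V. P v (x v) (H v) = Decide (\<forall>u\<in>V. \<forall>w\<in>V. x u = x w)) \<and>
        (\<forall>v\<in>V. \<forall>w\<in>V. received_from w (H v) = sent_to v (H w)))"

definition protocol_cost :: "'a set \<Rightarrow> 'a set set \<Rightarrow> nat \<Rightarrow> 'a protocol \<Rightarrow> enat" where
  "protocol_cost V E n P =
     (SUP x\<in>inputs V n. SUP H\<in>reachable V E P x. enat (bits_sent V H))"

definition equality_cost :: "nat \<Rightarrow> 'a set \<Rightarrow> 'a set set \<Rightarrow> nat" where
  "equality_cost n V E =
     (LEAST c. \<exists>P. decides_equality V E n P \<and> protocol_cost V E n P = enat c)"

text \<open>The limit exists on connected graphs: running two protocols one after the other shows that
  \<open>\<lambda>n. equality_cost n V E\<close> is subadditive.\<close>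

definition equality_rate :: "'a set \<Rightarrow> 'a set set \<Rightarrow> real" where
  "equality_rate V E = lim (\<lambda>n. real (equality_cost n V E) / real n)"

end

theory Submission
  imports Defs "HOL-Library.Sublist" "HOL-Real_Asymp.Real_Asymp"
begin

text \<open>
  Lower bound: on a diagonal input, where all players hold the same string \<open>s\<close>, the bits crossing a
  fixed cut determine \<open>s\<close>, for otherwise two diagonal runs could be pasted together along the cut
  into an accepting run on a non-constant input. Only few transcripts have total length at most
  \<open>k = n - \<lceil>sqrt n\<rceil>\<close>, so for large \<open>n\<close> the union bound over all cuts yields one \<open>s\<close> for which
  more than \<open>k\<close> bits cross every cut simultaneously. Weighting the cuts by a fractional packing
  counts every transmitted bit at most once, hence the cost is at least \<open>k\<close> times the size of the
  packing; divide by \<open>n\<close>.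

  That the limit defining the rate exists is Fekete's lemma, with subadditivity from sequential
  composition of protocols. Asynchrony is harmless throughout: every player has at most one possible
  next event and events of different players commute, so a single completed execution determines
  the outcome and the cost of all executions on the same input.
\<close>

section \<open>Executions\<close>

text \<open>A step is split into what the program of the acting player prescribes
  (\<open>follows\<close>, depending on its own input and history only) and what the channels supply
  (\<open>available\<close>). The local half alone also makes sense for pasted histories that come
  from no single run.\<close>

fun follows :: "'a set set \<Rightarrow> 'a \<Rightarrow> 'a action \<Rightarrow> 'a event \<Rightarrow> bool" where
  "follows E v a (Sent w b) \<longleftrightarrow> {v, w} \<in> E \<and> a = Send w b"
| "follows E v a (Received w b) \<longleftrightarrow> {v, w} \<in> E \<and> a = Receive w"

fun available :: "'a config \<Rightarrow> 'a \<Rightarrow> 'a event \<Rightarrow> bool" where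
  "available H v (Sent w b) \<longleftrightarrow> True"
| "available H v (Received w b) \<longleftrightarrow> (\<exists>bs. sent_to v (H w) = received_from w (H v) @ b # bs)"

definition enabled :: "'a set \<Rightarrow> 'a set set \<Rightarrow> 'a protocol \<Rightarrow> ('a \<Rightarrow> bool list) \<Rightarrow> 'a config \<Rightarrow>
    'a \<Rightarrow> 'a event \<Rightarrow> bool" where
  "enabled V E P x H v e \<longleftrightarrow> v \<in> V \<and> follows E v (P v (x v) (H v)) e \<and> available H v e"

lemma step_iff:
  "step V E P x H H' \<longleftrightarrow> (\<exists>v e. enabled V E P x H v e \<and> H' = H(v := H v @ [e]))"
proof
  assume "step V E P x H H'"
  then show "\<exists>v e. enabled V E P x H v e \<and> H' = H(v := H v @ [e])"
  proof cases
    case (send v w b)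
    then show ?thesis by (intro exI[of _ v] exI[of _ "Sent w b"]) (simp add: enabled_def)
  next
    case (receive v w b bs)
    then show ?thesis by (intro exI[of _ v] exI[of _ "Received w b"]) (simp add: enabled_def)
  qed
next
  assume "\<exists>v e. enabled V E P x H v e \<and> H' = H(v := H v @ [e])"
  then obtain v e where "enabled V E P x H v e" and H': "H' = H(v := H v @ [e])" by blast
  then show "step V E P x H H'"
    by (cases e) (auto simp: enabled_def intro: step.intros)
qed

lemma sent_to_simps [simp]:
  "sent_to v [] = []"
  "sent_to v (Sent w b # h) = (if w = v then b # sent_to v h else sent_to v h)"
  "sent_to v (Received w b # h) = sent_to v h"
  "sent_to v (h @ h') = sent_to v h @ sent_to v h'"
  by (simp_all add: sent_to_def)

lemma sent_to_nonempty: "sent_to w h \<noteq> [] \<Longrightarrow> \<exists>b. Sent w b \<in> set h"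
proof (induction h)
  case (Cons e h)
  then show ?case by (cases e) (auto split: if_splits)
qed simp

lemma received_from_simps [simp]:
  "received_from v [] = []"
  "received_from v (Received w b # h) = (if w = v then b # received_from v h else received_from v h)"
  "received_from v (Sent w b # h) = received_from v h"
  "received_from v (h @ h') = received_from v h @ received_from v h'"
  by (simp_all add: received_from_def)

lemma prefix_sent_to: "prefix h h' \<Longrightarrow> prefix (sent_to v h) (sent_to v h')"
  by (auto simp: prefix_def)

lemma simple_graph_edge:
  assumes "simple_graph V E" "{v, w} \<in> E"
  shows "v \<in> V" "w \<in> V" "v \<noteq> w"
proof -
  obtain a b where "a \<in> V" "b \<in> V" "a \<noteq> b" "{v, w} = {a, b}"
    using assms unfolding simple_graph_def by blast
  then show "v \<in> V" "w \<in> V" "v \<noteq> w" by (auto simp: doubleton_eq_iff)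
qed

section \<open>Confluence of executions\<close>

lemma enabled_unique:
  assumes "enabled V E P x H v e" "enabled V E P x H v e'"
  shows "e = e'"
  using assms by (cases e; cases e') (auto simp: enabled_def)

text \<open>The history of \<open>v\<close> is untouched, and \<open>u\<close> can only append to a
  channel towards \<open>v\<close>, so the bit at its front stays the same.\<close>

lemma enabled_persists:
  assumes "enabled V E P x H v e" "u \<noteq> v"
  shows "enabled V E P x (H(u := H u @ [f])) v e"
  using assms by (cases e) (auto simp: enabled_def)

text \<open>A player has at most one enabled event, so different successors come from different
  players, and their events commute.\<close>

lemma step_diamond:
  assumes "step V E P x H H1" "step V E P x H H2" "H1 \<noteq> H2"
  shows "\<exists>H3. step V E P x H1 H3 \<and> step V E P x H2 H3"
proof -
  obtain u e where u: "enabled V E P x H u e" "H1 = H(u := H u @ [e])"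
    using assms(1) by (auto simp: step_iff)
  obtain v f where v: "enabled V E P x H v f" "H2 = H(v := H v @ [f])"
    using assms(2) by (auto simp: step_iff)
  have "u \<noteq> v" using u v assms(3) enabled_unique by metis
  then have "enabled V E P x H1 v f" "enabled V E P x H2 u e"
    using u v enabled_persists by metis+
  moreover have "H1(v := H1 v @ [f]) = H2(u := H2 u @ [e])"
    using \<open>u \<noteq> v\<close> u v by (auto simp: fun_upd_twist)
  ultimately show ?thesis unfolding step_iff by metis
qed

text \<open>Completing diamonds along a run to a terminal configuration moves any possible first
  step to its front and keeps its length. Hence no step leads away from \<open>F\<close>.\<close>

lemma step_to_terminal:
  assumes "(step V E P x ^^ n) H F" "\<nexists>F'. step V E P x F F'" "step V E P x H H1"
  shows "\<exists>m. n = Suc m \<and> (step V E P x ^^ m) H1 F"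
  using assms
proof (induction n arbitrary: H H1)
  case 0
  then show ?case by auto
next
  case (Suc n)
  then obtain H' where H': "step V E P x H H'" "(step V E P x ^^ n) H' F"
    using relpowp_Suc_D2[OF Suc.prems(1)] by blast
  show ?case
  proof (cases "H' = H1")
    case True
    then show ?thesis using H' by blast
  next
    case False
    then obtain H3 where "step V E P x H' H3" "step V E P x H1 H3"
      using step_diamond[OF H'(1) Suc.prems(3)] by blast
    then obtain m where m: "n = Suc m" "(step V E P x ^^ m) H3 F"
      using Suc.IH[OF H'(2) Suc.prems(2)] by blast
    from relpowp_Suc_I2[OF \<open>step V E P x H1 H3\<close> m(2)] show ?thesis using m(1) by simp
  qed
qed

lemma reachable_to_terminal:
  assumes "F \<in> reachable V E P x" "\<nexists>F'. step V E P x F F'" "H \<in> reachable V E P x"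
  shows "(step V E P x)\<^sup>*\<^sup>* H F"
proof -
  have "(step V E P x)\<^sup>*\<^sup>* (\<lambda>_. []) H" using assms by (simp add: reachable_def)
  then show ?thesis
  proof (induction rule: rtranclp_induct)
    case base
    then show ?case using assms by (simp add: reachable_def)
  next
    case (step H H')
    from rtranclp_imp_relpowp[OF step.IH] obtain n where "(step V E P x ^^ n) H F" ..
    from step_to_terminal[OF this assms(2) step.hyps(2)] obtain m
      where "(step V E P x ^^ m) H' F" by blast
    then show ?case by (rule relpowp_imp_rtranclp)
  qed
qed

lemma reachable_start: "(\<lambda>_. []) \<in> reachable V E P x"
  by (simp add: reachable_def)

lemma reachable_step:
  "H \<in> reachable V E P x \<Longrightarrow> step V E P x H H' \<Longrightarrow> H' \<in> reachable V E P x"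
  by (simp add: reachable_def)

lemma reachable_enabled:
  "H \<in> reachable V E P x \<Longrightarrow> enabled V E P x H v e \<Longrightarrow> H(v := H v @ [e]) \<in> reachable V E P x"
  by (rule reachable_step) (auto simp: step_iff)

lemma reachable_induct [consumes 1, case_names start step]:
  assumes "H \<in> reachable V E P x" "Q (\<lambda>_. [])"
    "\<And>H v e. H \<in> reachable V E P x \<Longrightarrow> Q H \<Longrightarrow> enabled V E P x H v e \<Longrightarrow> Q (H(v := H v @ [e]))"
  shows "Q H"
proof -
  have "(step V E P x)\<^sup>*\<^sup>* (\<lambda>_. []) H" using assms(1) by (simp add: reachable_def)
  then show ?thesis
  proof (induction rule: rtranclp_induct)
    case base
    then show ?case by (rule assms(2))
  next
    case (step H H')
    then show ?case using assms(3)[of H] by (auto simp: step_iff reachable_def)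
  qed
qed

text \<open>This extracts from reachability a property of each history by itself, which survives
  when histories of two runs are pasted together.\<close>

lemma reachable_follows:
  assumes "H \<in> reachable V E P x" "H v = p @ e # q"
  shows "follows E v (P v (x v) p) e"
  using assms
proof (induction arbitrary: q rule: reachable_induct)
  case (step H u f)
  show ?case
  proof (cases "u = v \<and> q = []")
    case True
    then show ?thesis using step by (auto simp: enabled_def)
  next
    case False
    then have "\<exists>q'. H v = p @ e # q'"
      using step.prems by (cases q rule: rev_cases) (auto split: if_splits)
    then show ?thesis using step.IH by blast
  qed
qed simp

text \<open>A player that has decided takes no further step. The end of a completed run is therefore
  recognizable in a longer history as the first prefix with a decision.\<close>

lemma reachable_no_decision:
  assumes "H \<in> reachable V E P x" "k < length (H v)"
  shows "P v (x v) (take k (H v)) \<noteq> Decide d"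
proof -
  have "H v = take k (H v) @ H v ! k # drop (Suc k) (H v)"
    using assms(2) by (simp add: id_take_nth_drop)
  from reachable_follows[OF assms(1) this] show ?thesis by (cases "H v ! k") auto
qed

lemma reachable_received_prefix:
  "H \<in> reachable V E P x \<Longrightarrow> prefix (received_from w (H v)) (sent_to v (H w))"
proof (induction rule: reachable_induct)
  case (step H u e)
  then have "v = u \<Longrightarrow> prefix (received_from w (H v @ [e])) (sent_to v (H w))"
    by (cases e) (auto simp: enabled_def prefix_def)
  moreover have "prefix (received_from w h) (sent_to v (H w @ [e]))"
    if "prefix (received_from w h) (sent_to v (H w))" for h
    using that by (auto simp: prefix_def)
  ultimately show ?case using step.IH by auto
qed simp

section \<open>Counting events and transmitted bits\<close>

lemma length_sends_eq_sum:
  assumes "finite V" "\<And>w b. Sent w b \<in> set h \<Longrightarrow> w \<in> V"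
  shows "length [b. Sent w b \<leftarrow> h] = (\<Sum>w\<in>V. length (sent_to w h))"
  using assms(2)
proof (induction h)
  case (Cons e h)
  then have IH: "length [b. Sent w b \<leftarrow> h] = (\<Sum>w\<in>V. length (sent_to w h))" by auto
  show ?case
  proof (cases e)
    case (Sent w b)
    then have w: "w \<in> V" using Cons.prems[of w b] by simp
    have "(\<Sum>w'\<in>V. length (sent_to w' (e # h)))
        = (\<Sum>w'\<in>V. (if w = w' then 1 else 0) + length (sent_to w' h))"
      using Sent by (intro sum.cong) auto
    then show ?thesis using Sent w IH assms(1) by (simp add: sum.distrib)
  qed (use IH in simp)
qed simp

lemma length_receipts_eq_sum:
  assumes "finite V" "\<And>w b. Received w b \<in> set h \<Longrightarrow> w \<in> V"
  shows "length [b. Received w b \<leftarrow> h] = (\<Sum>w\<in>V. length (received_from w h))"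
  using assms(2)
proof (induction h)
  case (Cons e h)
  then have IH: "length [b. Received w b \<leftarrow> h] = (\<Sum>w\<in>V. length (received_from w h))" by auto
  show ?case
  proof (cases e)
    case (Received w b)
    then have w: "w \<in> V" using Cons.prems[of w b] by simp
    have "(\<Sum>w'\<in>V. length (received_from w' (e # h)))
        = (\<Sum>w'\<in>V. (if w = w' then 1 else 0) + length (received_from w' h))"
      using Received by (intro sum.cong) auto
    then show ?thesis using Received w IH assms(1) by (simp add: sum.distrib)
  qed (use IH in simp)
qed simp

lemma length_eq_sends_receipts:
  "length h = length [b. Sent w b \<leftarrow> h] + length [b. Received w b \<leftarrow> h]"
proof (induction h)
  case (Cons e h)
  then show ?case by (cases e) auto
qed simp

lemma reachable_event_in_graph:
  assumes "H \<in> reachable V E P x" "e \<in> set (H v)"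
  shows "case e of Sent w b \<Rightarrow> {v, w} \<in> E | Received w b \<Rightarrow> {v, w} \<in> E"
proof -
  obtain p q where "H v = p @ e # q" using split_list[OF assms(2)] by blast
  from reachable_follows[OF assms(1) this] show ?thesis by (cases e) auto
qed

lemma bits_sent_eq_sum:
  assumes "simple_graph V E" "H \<in> reachable V E P x"
  shows "bits_sent V H = (\<Sum>v\<in>V. \<Sum>w\<in>V. length (sent_to w (H v)))"
proof -
  have "finite V" using assms(1) by (simp add: simple_graph_def)
  moreover have "w \<in> V" if "Sent w b \<in> set (H v)" for v w b
    using reachable_event_in_graph[OF assms(2) that] simple_graph_edge[OF assms(1)] by simp
  ultimately show ?thesis unfolding bits_sent_def
    by (intro sum.cong refl length_sends_eq_sum) auto
qed

text \<open>The bits received over a channel form a prefix of those sent over it, so there are at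
  most as many receipts as sends.\<close>

lemma sum_length_le_bits_sent:
  assumes "simple_graph V E" "H \<in> reachable V E P x"
  shows "(\<Sum>v\<in>V. length (H v)) \<le> 2 * bits_sent V H"
proof -
  have fin: "finite V" using assms(1) by (simp add: simple_graph_def)
  have "w \<in> V" if "Received w b \<in> set (H v)" for v w b
    using reachable_event_in_graph[OF assms(2) that] simple_graph_edge[OF assms(1)] by simp
  then have "(\<Sum>v\<in>V. length [b. Received w b \<leftarrow> H v])
      = (\<Sum>v\<in>V. \<Sum>w\<in>V. length (received_from w (H v)))"
    by (intro sum.cong refl length_receipts_eq_sum[OF fin]) auto
  also have "\<dots> \<le> (\<Sum>v\<in>V. \<Sum>w\<in>V. length (sent_to v (H w)))"
    by (intro sum_mono prefix_length_le reachable_received_prefix[OF assms(2)])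
  also have "\<dots> = bits_sent V H"
    unfolding bits_sent_eq_sum[OF assms] by (rule sum.swap)
  finally have "(\<Sum>v\<in>V. length [b. Received w b \<leftarrow> H v]) \<le> bits_sent V H" .
  moreover have "(\<Sum>v\<in>V. length (H v))
      = bits_sent V H + (\<Sum>v\<in>V. length [b. Received w b \<leftarrow> H v])"
    unfolding bits_sent_def sum.distrib[symmetric]
    by (intro sum.cong refl length_eq_sends_receipts)
  ultimately show ?thesis by simp
qed

lemma bits_sent_mono:
  assumes "(step V E P x)\<^sup>*\<^sup>* H F"
  shows "bits_sent V H \<le> bits_sent V F"
  using assms
proof (induction rule: rtranclp_induct)
  case (step F F')
  have "bits_sent V F \<le> bits_sent V F'"
    using step.hyps(2) unfolding bits_sent_def step_iff by (auto intro!: sum_mono)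
  then show ?case using step.IH by simp
qed simp

text \<open>Bounded cost bounds the number of events, so some reachable configuration has the most
  events; it cannot be continued.\<close>

lemma ex_terminal:
  assumes "simple_graph V E" "\<And>H. H \<in> reachable V E P x \<Longrightarrow> bits_sent V H \<le> c"
  shows "\<exists>F \<in> reachable V E P x. \<nexists>F'. step V E P x F F'"
proof -
  have fin: "finite V" using assms(1) by (simp add: simple_graph_def)
  let ?m = "\<lambda>H. \<Sum>v\<in>V. length (H v)"
  have "?m H < Suc (2 * c)" if "H \<in> reachable V E P x" for H
    using sum_length_le_bits_sent[OF assms(1) that] assms(2)[OF that] by simp
  then have "\<forall>H. H \<in> reachable V E P x \<longrightarrow> ?m H < Suc (2 * c)" by blast
  then obtain F where F: "F \<in> reachable V E P x" "\<And>H. H \<in> reachable V E P x \<Longrightarrow> ?m H \<le> ?m F"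
    using ex_has_greatest_nat[of "\<lambda>H. H \<in> reachable V E P x" "\<lambda>_. []" ?m "Suc (2 * c)"] reachable_start
    by blast
  have "False" if s: "step V E P x F F'" for F'
  proof -
    obtain v e where ve: "v \<in> V" "F' = F(v := F v @ [e])"
      using s by (auto simp: step_iff enabled_def)
    have "?m F < ?m F'" using ve fin by (intro sum_strict_mono_ex1) auto
    then show False using F(2)[OF reachable_step[OF F(1) s]] by simp
  qed
  then show ?thesis using F(1) by blast
qed

text \<open>The channels are required to be empty so that another protocol can start afterwards. The
  decision may vary with the player, because intermediate phases use it as a computed bit.\<close>

definition completes :: "'a set \<Rightarrow> 'a set set \<Rightarrow> 'a protocol \<Rightarrow> ('a \<Rightarrow> bool list) \<Rightarrow> 'a config \<Rightarrow>
    ('a \<Rightarrow> bool) \<Rightarrow> bool" where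
  "completes V E P x F d \<longleftrightarrow> F \<in> reachable V E P x \<and> (\<forall>v\<in>V. P v (x v) (F v) = Decide (d v)) \<and>
     (\<forall>v\<in>V. \<forall>w\<in>V. received_from w (F v) = sent_to v (F w))"

lemma completes_terminal:
  assumes "completes V E P x F d"
  shows "\<nexists>F'. step V E P x F F'"
proof
  assume "\<exists>F'. step V E P x F F'"
  then obtain v e where "enabled V E P x F v e" by (auto simp: step_iff)
  then show False using assms by (cases e) (auto simp: enabled_def completes_def)
qed

definition all_equal :: "'a set \<Rightarrow> ('a \<Rightarrow> 'b) \<Rightarrow> bool" where
  "all_equal V x \<longleftrightarrow> (\<forall>u\<in>V. \<forall>w\<in>V. x u = x w)"

text \<open>By confluence, one completed execution per input speaks for all of them, so an
  existential form suffices. The bound \<open>c\<close> need not be attained, which makes it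
  additive under composition.\<close>

definition equality_protocol :: "nat \<Rightarrow> 'a set \<Rightarrow> 'a set set \<Rightarrow> nat \<Rightarrow> 'a protocol \<Rightarrow> bool" where
  "equality_protocol n V E c P \<longleftrightarrow> (\<forall>x\<in>inputs V n. \<exists>F.
     completes V E P x F (\<lambda>_. all_equal V x) \<and> bits_sent V F \<le> c)"

lemma equality_protocolI:
  assumes "simple_graph V E" "decides_equality V E n P" "protocol_cost V E n P = enat c"
  shows "equality_protocol n V E c P"
  unfolding equality_protocol_def
proof
  fix x assume x: "x \<in> inputs V n"
  have le: "bits_sent V H \<le> c" if "H \<in> reachable V E P x" for H
  proof -
    have "enat (bits_sent V H) \<le> protocol_cost V E n P"
      unfolding protocol_cost_def using x that by (meson SUP_upper2 order_refl)
    then show ?thesis using assms(3) by simp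
  qed
  from ex_terminal[OF assms(1) this] obtain F
    where "F \<in> reachable V E P x" "\<nexists>F'. step V E P x F F'" by blast
  then have "completes V E P x F (\<lambda>_. all_equal V x)"
    using assms(2) x unfolding decides_equality_def completes_def all_equal_def by blast
  then show "\<exists>F. completes V E P x F (\<lambda>_. all_equal V x) \<and> bits_sent V F \<le> c"
    using le by (auto simp: completes_def)
qed

lemma equality_protocolD:
  assumes "equality_protocol n V E c P"
  shows "decides_equality V E n P" "protocol_cost V E n P \<le> enat c"
proof -
  \<comment> \<open>Every partial execution extends to the completed one, which therefore fixes the
    outcome and bounds the cost.\<close>
  have main: "(step V E P x)\<^sup>*\<^sup>* H F"
    if "completes V E P x F d" "H \<in> reachable V E P x" for x H F d
    using reachable_to_terminal[OF _ completes_terminal[OF that(1)] that(2)] that(1)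
    by (simp add: completes_def)
  show "decides_equality V E n P"
    unfolding decides_equality_def
  proof (intro ballI impI)
    fix x H assume x: "x \<in> inputs V n" and H: "H \<in> reachable V E P x" "\<nexists>H'. step V E P x H H'"
    obtain F where F: "completes V E P x F (\<lambda>_. all_equal V x)"
      using assms x by (auto simp: equality_protocol_def)
    have "H = F" using main[OF F H(1)] H(2) by (blast elim: converse_rtranclpE)
    then show "(\<forall>v\<in>V. P v (x v) (H v) = Decide (\<forall>u\<in>V. \<forall>w\<in>V. x u = x w)) \<and>
        (\<forall>v\<in>V. \<forall>w\<in>V. received_from w (H v) = sent_to v (H w))"
      using F by (simp add: completes_def all_equal_def)
  qed
  show "protocol_cost V E n P \<le> enat c"
    unfolding protocol_cost_def
  proof (intro SUP_least)
    fix x H assume x: "x \<in> inputs V n" and H: "H \<in> reachable V E P x"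
    obtain F where F: "completes V E P x F (\<lambda>_. all_equal V x)" "bits_sent V F \<le> c"
      using assms x by (auto simp: equality_protocol_def)
    show "enat (bits_sent V H) \<le> enat c"
      using bits_sent_mono[OF main[OF F(1) H]] F(2) by simp
  qed
qed

section \<open>Sequential composition\<close>

text \<open>A player sees only its joint history, so the phase boundary is recovered as the shortest
  prefix on which \<open>P\<close> decides. The maps \<open>f\<close> and \<open>g\<close> prepare
  the inputs of the two phases, \<open>g\<close> with access to the first decision, and
  \<open>c\<close> combines both decisions.\<close>

definition seq_protocol :: "(bool list \<Rightarrow> bool list) \<Rightarrow> 'a protocol \<Rightarrow>
    (bool list \<Rightarrow> bool \<Rightarrow> bool list) \<Rightarrow> 'a protocol \<Rightarrow> (bool \<Rightarrow> bool \<Rightarrow> bool) \<Rightarrow> 'a protocol" where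
  "seq_protocol f P g Q c v x h =
     (if \<exists>k d. P v (f x) (take k h) = Decide d then
        let k = LEAST k. \<exists>d. P v (f x) (take k h) = Decide d;
            d = (THE d. P v (f x) (take k h) = Decide d)
        in case Q v (g x d) (drop k h) of Decide d' \<Rightarrow> Decide (c d d') | a \<Rightarrow> a
      else P v (f x) h)"

lemma seq_protocol_first:
  assumes "\<And>k d. k \<le> length h \<Longrightarrow> P v (f x) (take k h) \<noteq> Decide d"
  shows "seq_protocol f P g Q c v x h = P v (f x) h"
proof -
  have "P v (f x) (take k h) \<noteq> Decide d" for k d
    using assms[of k d] assms[of "length h" d] by (cases "k \<le> length h") auto
  then show ?thesis by (simp add: seq_protocol_def)
qed

lemma seq_protocol_second:
  assumes "\<And>k d. k < length p \<Longrightarrow> P v (f x) (take k p) \<noteq> Decide d" "P v (f x) p = Decide d"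
  shows "seq_protocol f P g Q c v x (p @ h) =
    (case Q v (g x d) h of Decide d' \<Rightarrow> Decide (c d d') | a \<Rightarrow> a)"
proof -
  have "(LEAST k. \<exists>d. P v (f x) (take k (p @ h)) = Decide d) = length p"
  proof (rule Least_equality)
    fix k assume "\<exists>d. P v (f x) (take k (p @ h)) = Decide d"
    then show "length p \<le> k" using assms(1)[of k] by (cases "k < length p") auto
  qed (use assms(2) in simp)
  moreover have "\<exists>k d. P v (f x) (take k (p @ h)) = Decide d"
    using assms(2) by (intro exI[of _ "length p"] exI[of _ d]) simp
  ultimately show ?thesis using assms(2) by (simp add: seq_protocol_def)
qed

text \<open>It is enough to exhibit the schedule in which all of the first phase precedes the
  second. The first phase leaves every channel empty, so its events, put in front, do not change
  which bits are in transit later.\<close>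

lemma completes_seq_protocol:
  assumes G: "simple_graph V E"
    and "completes V E P y F d" "y = (\<lambda>v. f (x v))"
    and "completes V E Q z F' d'" "z = (\<lambda>v. g (x v) (d v))"
  shows "completes V E (seq_protocol f P g Q c) x (\<lambda>v. F v @ F' v) (\<lambda>v. c (d v) (d' v))"
proof -
  let ?R = "seq_protocol f P g Q c"
  have F: "F \<in> reachable V E P (\<lambda>v. f (x v))" "\<And>v. v \<in> V \<Longrightarrow> P v (f (x v)) (F v) = Decide (d v)"
    "\<And>v w. v \<in> V \<Longrightarrow> w \<in> V \<Longrightarrow> received_from w (F v) = sent_to v (F w)"
    using assms(2,3) by (auto simp: completes_def)
  have F': "F' \<in> reachable V E Q (\<lambda>v. g (x v) (d v))"
    "\<And>v. v \<in> V \<Longrightarrow> Q v (g (x v) (d v)) (F' v) = Decide (d' v)"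
    "\<And>v w. v \<in> V \<Longrightarrow> w \<in> V \<Longrightarrow> received_from w (F' v) = sent_to v (F' w)"
    using assms(4,5) by (auto simp: completes_def)
  have "H \<in> reachable V E ?R x" if "H \<in> reachable V E P (\<lambda>v. f (x v))" for H
    using that
  proof (induction rule: reachable_induct)
    case (step H v e)
    \<comment> \<open>No prefix carries a decision: proper prefixes because an event followed, the
      whole history because \<open>e\<close> is enabled.\<close>
    have "P v (f (x v)) (take k (H v)) \<noteq> Decide d" if "k \<le> length (H v)" for k d
    proof (cases "k = length (H v)")
      case True
      then show ?thesis using step.hyps(2) by (cases e) (auto simp: enabled_def)
    next
      case False
      then show ?thesis using reachable_no_decision[OF step.hyps(1)] that by simp
    qed
    then have "?R v (x v) (H v) = P v (f (x v)) (H v)" by (rule seq_protocol_first)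
    then have "enabled V E ?R x H v e" using step.hyps(2) by (simp add: enabled_def)
    then show ?case by (rule reachable_enabled[OF step.IH])
  qed (rule reachable_start)
  note start = this[OF F(1)]
  have second: "?R v (x v) (F v @ h) =
      (case Q v (g (x v) (d v)) h of Decide d' \<Rightarrow> Decide (c (d v) d') | a \<Rightarrow> a)" if "v \<in> V" for v h
    using reachable_no_decision[OF F(1)] F(2)[OF that] by (intro seq_protocol_second) auto
  have "(\<lambda>v. F v @ H v) \<in> reachable V E ?R x" if "H \<in> reachable V E Q (\<lambda>v. g (x v) (d v))" for H
    using that
  proof (induction rule: reachable_induct)
    case start
    then show ?case using \<open>F \<in> reachable V E ?R x\<close> by simp
  next
    case (step H v e)
    have v: "v \<in> V" using step.hyps(2) by (simp add: enabled_def)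
    have "enabled V E ?R x (\<lambda>v. F v @ H v) v e"
    proof (cases e)
      case (Sent w b)
      then show ?thesis using step.hyps(2) v second[OF v, of "H v"] by (simp add: enabled_def)
    next
      case (Received w b)
      then have "w \<in> V"
        using step.hyps(2) simple_graph_edge(2)[OF G, of v w] by (simp add: enabled_def)
      then show ?thesis using Received step.hyps(2) v second[OF v, of "H v"] F(3)[of v w]
        by (simp add: enabled_def)
    qed
    from reachable_enabled[OF step.IH this]
    have "(\<lambda>v. F v @ H v)(v := (F v @ H v) @ [e]) \<in> reachable V E ?R x" .
    moreover have "(\<lambda>v. F v @ H v)(v := (F v @ H v) @ [e]) = (\<lambda>u. F u @ (H(v := H v @ [e])) u)"
      by auto
    ultimately show ?case by simp
  qed
  from this[OF F'(1)] show ?thesis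
    using second F' F(3) by (simp add: completes_def)
qed

lemma bits_sent_append: "bits_sent V (\<lambda>v. F v @ F' v) = bits_sent V F + bits_sent V F'"
  unfolding bits_sent_def sum.distrib[symmetric] by (intro sum.cong refl) simp

text \<open>Strings agree iff their first \<open>m\<close> bits and their remaining bits agree, so
  the two blocks are tested in turn.\<close>

lemma equality_protocol_add:
  assumes "simple_graph V E" "equality_protocol m V E c P" "equality_protocol n V E c' Q"
  shows "equality_protocol (m + n) V E (c + c')
    (seq_protocol (take m) P (\<lambda>x _. drop m x) Q (\<and>))"
  unfolding equality_protocol_def
proof
  fix x assume x: "x \<in> inputs V (m + n)"
  have "(\<lambda>v. take m (x v)) \<in> inputs V m" "(\<lambda>v. drop m (x v)) \<in> inputs V n"
    using x by (auto simp: inputs_def)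
  then obtain F F' where F:
    "completes V E P (\<lambda>v. take m (x v)) F (\<lambda>_. all_equal V (\<lambda>v. take m (x v)))"
    "bits_sent V F \<le> c"
    "completes V E Q (\<lambda>v. drop m (x v)) F' (\<lambda>_. all_equal V (\<lambda>v. drop m (x v)))"
    "bits_sent V F' \<le> c'"
    using assms(2,3)[unfolded equality_protocol_def, THEN bspec] by blast
  have "all_equal V x \<longleftrightarrow> all_equal V (\<lambda>v. take m (x v)) \<and> all_equal V (\<lambda>v. drop m (x v))"
    unfolding all_equal_def by (metis append_take_drop_id)
  then have "completes V E (seq_protocol (take m) P (\<lambda>x _. drop m x) Q (\<and>)) x
      (\<lambda>v. F v @ F' v) (\<lambda>_. all_equal V x)"
    using completes_seq_protocol[where f = "take m" and g = "\<lambda>x _. drop m x" and c = "(\<and>)",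
        OF assms(1) F(1) refl F(3) refl] by simp
  then show "\<exists>F. completes V E (seq_protocol (take m) P (\<lambda>x _. drop m x) Q (\<and>)) x F
      (\<lambda>_. all_equal V x) \<and> bits_sent V F \<le> c + c'"
    using F(2,4) by (intro exI[of _ "\<lambda>v. F v @ F' v"]) (simp add: bits_sent_append)
qed

section \<open>Protocols for equality\<close>

text \<open>Here every player holds one bit, and its decision is read as its new bit, so that such
  transformations of the bits can be composed.\<close>

definition realizable :: "'a set \<Rightarrow> 'a set set \<Rightarrow> (('a \<Rightarrow> bool) \<Rightarrow> 'a \<Rightarrow> bool) \<Rightarrow> bool" where
  "realizable V E T \<longleftrightarrow> (\<exists>P c. \<forall>x. \<exists>F.
     completes V E P x F (T (\<lambda>v. hd (x v))) \<and> bits_sent V F \<le> c)"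

lemma realizable_id: "realizable V E (\<lambda>s. s)"
  unfolding realizable_def
  by (intro exI[of _ "\<lambda>v x h. Decide (hd x)"] exI[of _ 0] allI exI[of _ "\<lambda>_. []"])
    (simp add: completes_def reachable_start bits_sent_def)

lemma realizable_comp:
  assumes "simple_graph V E" "realizable V E T" "realizable V E T'"
  shows "realizable V E (\<lambda>s. T' (T s))"
proof -
  obtain P c where P: "\<And>x. \<exists>F. completes V E P x F (T (\<lambda>v. hd (x v))) \<and> bits_sent V F \<le> c"
    using assms(2) unfolding realizable_def by blast
  obtain Q c' where Q: "\<And>x. \<exists>F. completes V E Q x F (T' (\<lambda>v. hd (x v))) \<and> bits_sent V F \<le> c'"
    using assms(3) unfolding realizable_def by blast
  let ?R = "seq_protocol (\<lambda>x. x) P (\<lambda>_ d. [d]) Q (\<lambda>_ d. d)"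
  have "\<exists>F. completes V E ?R x F (T' (T (\<lambda>v. hd (x v)))) \<and> bits_sent V F \<le> c + c'" for x
  proof -
    obtain F where F: "completes V E P x F (T (\<lambda>v. hd (x v)))" "bits_sent V F \<le> c"
      using P by blast
    obtain F' where F': "completes V E Q (\<lambda>v. [T (\<lambda>v. hd (x v)) v]) F' (T' (T (\<lambda>v. hd (x v))))"
        "bits_sent V F' \<le> c'"
      using Q[of "\<lambda>v. [T (\<lambda>v. hd (x v)) v]"] by auto
    have "completes V E ?R x (\<lambda>v. F v @ F' v) (T' (T (\<lambda>v. hd (x v))))"
      by (rule completes_seq_protocol[where f = "\<lambda>x. x" and g = "\<lambda>_ d. [d]" and c = "\<lambda>_ d. d",
        OF assms(1) F(1) refl F'(1) refl])
    then show ?thesis using F(2) F'(2)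
      by (intro exI[of _ "\<lambda>v. F v @ F' v"]) (simp add: bits_sent_append)
  qed
  then show ?thesis unfolding realizable_def by blast
qed

text \<open>A single transmission: \<open>u\<close> sends its bit, \<open>w\<close> conjoins it with
  its own, and all other players stop at once.\<close>

lemma realizable_edge:
  assumes G: "simple_graph V E" and e: "{u, w} \<in> E"
  shows "realizable V E (\<lambda>s. s(w := s w \<and> s u))"
proof -
  have uw: "u \<in> V" "w \<in> V" "u \<noteq> w" using simple_graph_edge[OF G e] by auto
  have fin: "finite V" using G by (simp add: simple_graph_def)
  define P :: "'a protocol" where "P = (\<lambda>v x h.
    if v = u then (if h = [] then Send w (hd x) else Decide (hd x))
    else if v = w then (if h = [] then Receive u else Decide (hd x \<and> hd h = Received u True))
    else Decide (hd x))"
  have "\<exists>F. completes V E P x F ((\<lambda>s. s(w := s w \<and> s u)) (\<lambda>v. hd (x v))) \<and> bits_sent V F \<le> 1" for x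
  proof -
    let ?b = "hd (x u)"
    let ?H = "(\<lambda>_. [])(u := [Sent w ?b])"
    let ?F = "?H(w := [Received u ?b])"
    have "enabled V E P x (\<lambda>_. []) u (Sent w ?b)"
      using uw e by (simp add: enabled_def P_def)
    from reachable_enabled[OF reachable_start this] have H: "?H \<in> reachable V E P x" by simp
    have "enabled V E P x ?H w (Received u ?b)"
      using uw e by (simp add: enabled_def P_def insert_commute)
    from reachable_enabled[OF H this] have "?F \<in> reachable V E P x" using uw by simp
    then have "completes V E P x ?F ((\<lambda>s. s(w := s w \<and> s u)) (\<lambda>v. hd (x v)))"
      using uw by (auto simp: completes_def P_def)
    moreover have "bits_sent V ?F = (\<Sum>v\<in>V. if v = u then 1 else 0)"
      unfolding bits_sent_def using uw by (intro sum.cong) auto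
    ultimately show ?thesis using fin uw by (intro exI[of _ ?F]) simp
  qed
  then show ?thesis unfolding realizable_def by blast
qed

text \<open>Contrapositively, a False at \<open>u\<close> always arrives at
  \<open>w\<close>.\<close>

definition forwards :: "(('a \<Rightarrow> bool) \<Rightarrow> 'a \<Rightarrow> bool) \<Rightarrow> 'a \<Rightarrow> 'a \<Rightarrow> bool" where
  "forwards T u w \<longleftrightarrow> (\<forall>s. T s w \<longrightarrow> s u)"

text \<open>A False persists where it is, and none arises from an all-True assignment. Both
  properties survive composition; with forwarding between all pairs they force the
  conjunction.\<close>

definition and_sound :: "'a set \<Rightarrow> (('a \<Rightarrow> bool) \<Rightarrow> 'a \<Rightarrow> bool) \<Rightarrow> bool" where
  "and_sound V T \<longleftrightarrow> (\<forall>v. forwards T v v) \<and> (\<forall>s. (\<forall>v\<in>V. s v) \<longrightarrow> (\<forall>v\<in>V. T s v))"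

lemma forwards_comp:
  assumes "forwards T u v" "forwards T' v w"
  shows "forwards (\<lambda>s. T' (T s)) u w"
  unfolding forwards_def
proof (intro allI impI)
  fix s assume "T' (T s) w"
  then have "T s v" using assms(2) by (auto simp: forwards_def)
  then show "s u" using assms(1) by (auto simp: forwards_def)
qed

lemma and_sound_comp:
  assumes "and_sound V T" "and_sound V T'"
  shows "and_sound V (\<lambda>s. T' (T s))"
  unfolding and_sound_def
proof
  show "\<forall>v. forwards (\<lambda>s. T' (T s)) v v"
    using assms forwards_comp unfolding and_sound_def by fast
  show "\<forall>s. (\<forall>v\<in>V. s v) \<longrightarrow> (\<forall>v\<in>V. T' (T s) v)"
    using assms unfolding and_sound_def by simp
qed

lemma and_sound_id: "and_sound V (\<lambda>s. s)"
  by (simp add: and_sound_def forwards_def)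

lemma and_sound_edge: "u \<in> V \<Longrightarrow> and_sound V (\<lambda>s. s(w := s w \<and> s u))"
  by (simp add: and_sound_def forwards_def)

text \<open>The bit travels edge by edge, each vertex conjoining what arrives with its own
  bit.\<close>

lemma realizable_path:
  assumes "simple_graph V E" "(u, w) \<in> {(a, b). {a, b} \<in> E}\<^sup>*"
  shows "\<exists>T. realizable V E T \<and> and_sound V T \<and> forwards T u w"
  using assms(2)
proof (induction rule: rtrancl_induct)
  case base
  have "forwards (\<lambda>s. s) u u" by (simp add: forwards_def)
  then show ?case using realizable_id and_sound_id by blast
next
  case (step w z)
  then obtain T where T: "realizable V E T" "and_sound V T" "forwards T u w" by blast
  have e: "{w, z} \<in> E" using step.hyps(2) by simp
  let ?T = "\<lambda>s. s(z := s z \<and> s w)"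
  have "forwards ?T w z" by (simp add: forwards_def)
  from forwards_comp[OF T(3) this]
    realizable_comp[OF assms(1) T(1) realizable_edge[OF assms(1) e]]
    and_sound_comp[OF T(2) and_sound_edge[OF simple_graph_edge(1)[OF assms(1) e], where w = z]]
  show ?case by (intro exI[of _ "\<lambda>s. ?T (T s)"] conjI)
qed

text \<open>Path protocols for all pairs of vertices are composed. This is wasteful, but only a
  finite cost is wanted here.\<close>

lemma realizable_conjunction:
  assumes "connected_graph V E"
  shows "\<exists>T. realizable V E T \<and> (\<forall>s. \<forall>w\<in>V. T s w \<longleftrightarrow> (\<forall>u\<in>V. s u))"
proof -
  have G: "simple_graph V E" using assms by (simp add: connected_graph_def)
  have "finite (V \<times> V)" using G by (simp add: simple_graph_def)
  moreover have "\<exists>T. realizable V E T \<and> and_sound V T \<and> (\<forall>(u, w)\<in>A. forwards T u w)"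
    if "finite A" "A \<subseteq> V \<times> V" for A
    using that
  proof (induction rule: finite_induct)
    case empty
    then show ?case using realizable_id and_sound_id by blast
  next
    case (insert p A)
    then obtain T where T: "realizable V E T" "and_sound V T" "\<forall>(u, w)\<in>A. forwards T u w"
      by auto
    obtain u w where p: "p = (u, w)" "u \<in> V" "w \<in> V" using insert.prems by auto
    then have "(u, w) \<in> {(a, b). {a, b} \<in> E}\<^sup>*" using assms by (simp add: connected_graph_def)
    from realizable_path[OF G this] obtain T' where
      T': "realizable V E T'" "and_sound V T'" "forwards T' u w" by blast
    \<comment> \<open>For an old pair the target keeps its False during \<open>T'\<close>; for the
      new pair the source keeps it during \<open>T\<close>.\<close>
    have "forwards T v v" "forwards T' v v" for v
      using T(2) T'(2) by (auto simp: and_sound_def)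
    then have "\<forall>(u, w)\<in>insert p A. forwards (\<lambda>s. T' (T s)) u w"
      using T(3) T'(3) p(1) forwards_comp by fast
    then show ?case using realizable_comp[OF G T(1) T'(1)] and_sound_comp[OF T(2) T'(2)]
      by (intro exI[of _ "\<lambda>s. T' (T s)"]) simp
  qed
  ultimately obtain T where T: "realizable V E T" "and_sound V T"
    "\<forall>(u, w)\<in>V \<times> V. forwards T u w" by blast
  have "T s w \<longleftrightarrow> (\<forall>u\<in>V. s u)" if w: "w \<in> V" for s w
  proof
    assume "T s w"
    then show "\<forall>u\<in>V. s u" using T(3) w by (auto simp: forwards_def)
  next
    assume "\<forall>u\<in>V. s u"
    then show "T s w" using T(2) w by (simp add: and_sound_def)
  qed
  then show ?thesis using T(1) by (intro exI[of _ T]) simp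
qed

lemma completes_cong:
  "completes V E P x F d \<Longrightarrow> (\<And>v. v \<in> V \<Longrightarrow> d v = d' v) \<Longrightarrow> completes V E P x F d'"
  by (simp add: completes_def)

text \<open>Single bits are all equal iff their conjunction or the conjunction of their negations holds.\<close>

lemma ex_equality_protocol_1:
  assumes "connected_graph V E"
  shows "\<exists>P c. equality_protocol 1 V E c P"
proof -
  have G: "simple_graph V E" using assms by (simp add: connected_graph_def)
  obtain T where T: "realizable V E T" "\<And>s w. w \<in> V \<Longrightarrow> T s w \<longleftrightarrow> (\<forall>u\<in>V. s u)"
    using realizable_conjunction[OF assms] by blast
  then obtain P c where P: "\<And>x. \<exists>F. completes V E P x F (T (\<lambda>v. hd (x v))) \<and> bits_sent V F \<le> c"
    unfolding realizable_def by blast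
  let ?R = "seq_protocol (\<lambda>x. x) P (\<lambda>x _. map Not x) P (\<or>)"
  have "\<exists>F. completes V E ?R x F (\<lambda>_. all_equal V x) \<and> bits_sent V F \<le> c + c"
    if x: "x \<in> inputs V 1" for x
  proof -
    obtain F where F: "completes V E P x F (T (\<lambda>v. hd (x v)))" "bits_sent V F \<le> c"
      using P by blast
    obtain F' where F': "completes V E P (\<lambda>v. map Not (x v)) F' (T (\<lambda>v. hd (map Not (x v))))"
        "bits_sent V F' \<le> c"
      using P by blast
    have x1: "\<exists>b. x v = [b]" if "v \<in> V" for v
      using x that by (auto simp: inputs_def length_Suc_conv)
    have "(T (\<lambda>v. hd (x v)) v \<or> T (\<lambda>v. hd (map Not (x v))) v) = all_equal V x" if "v \<in> V" for v
    proof -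
      have "x u = x w \<longleftrightarrow> hd (x u) = hd (x w)" "hd (map Not (x u)) \<longleftrightarrow> \<not> hd (x u)"
        if "u \<in> V" "w \<in> V" for u w
        using x1[OF that(1)] x1[OF that(2)] by auto
      then show ?thesis using T(2)[OF that] that unfolding all_equal_def by auto
    qed
    then have "completes V E ?R x (\<lambda>v. F v @ F' v) (\<lambda>_. all_equal V x)"
      by (rule completes_cong[OF completes_seq_protocol[where f = "\<lambda>x. x"
        and g = "\<lambda>x _. map Not x" and c = "(\<or>)", OF G F(1) refl F'(1) refl]])
    then show ?thesis using F(2) F'(2)
      by (intro exI[of _ "\<lambda>v. F v @ F' v"]) (simp add: bits_sent_append)
  qed
  then show ?thesis unfolding equality_protocol_def by blast
qed

lemma equality_protocol_0: "equality_protocol 0 V E 0 (\<lambda>_ _ _. Decide True)"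
  unfolding equality_protocol_def
  by (intro ballI exI[of _ "\<lambda>_. []"])
    (auto simp: completes_def reachable_start bits_sent_def inputs_def all_equal_def)

text \<open>The strings are compared bit by bit. This makes the \<open>LEAST\<close> in
  \<open>equality_cost\<close> range over a nonempty set.\<close>

lemma ex_equality_protocol:
  assumes "connected_graph V E"
  shows "\<exists>P c. equality_protocol n V E c P"
proof (induction n)
  case 0
  show ?case using equality_protocol_0 by blast
next
  case (Suc n)
  have "simple_graph V E" using assms by (simp add: connected_graph_def)
  from equality_protocol_add[OF this] Suc.IH ex_equality_protocol_1[OF assms]
  have "\<exists>P c. equality_protocol (n + 1) V E c P" by blast
  then show ?case by simp
qed

section \<open>Optimal cost and its subadditivity\<close>

lemma equality_cost_le:
  assumes "equality_protocol n V E c P"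
  shows "equality_cost n V E \<le> c"
proof -
  obtain c' where c': "protocol_cost V E n P = enat c'" "c' \<le> c"
    using equality_protocolD(2)[OF assms] by (cases "protocol_cost V E n P") auto
  have "equality_cost n V E \<le> c'"
    unfolding equality_cost_def using equality_protocolD(1)[OF assms] c'(1)
    by (intro Least_le) blast
  then show ?thesis using c'(2) by simp
qed

lemma ex_optimal_equality_protocol:
  assumes "connected_graph V E"
  shows "\<exists>P. equality_protocol n V E (equality_cost n V E) P"
proof -
  obtain P c where P: "equality_protocol n V E c P" using ex_equality_protocol[OF assms] by blast
  obtain c' where "protocol_cost V E n P = enat c'"
    using equality_protocolD(2)[OF P] by (cases "protocol_cost V E n P") auto
  then have "\<exists>c P. decides_equality V E n P \<and> protocol_cost V E n P = enat c"
    using equality_protocolD(1)[OF P] by blast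
  from LeastI_ex[OF this] obtain Q where
    "decides_equality V E n Q" "protocol_cost V E n Q = enat (equality_cost n V E)"
    unfolding equality_cost_def by blast
  then show ?thesis using equality_protocolI assms unfolding connected_graph_def by blast
qed

lemma equality_cost_subadditive:
  assumes "connected_graph V E"
  shows "equality_cost (m + n) V E \<le> equality_cost m V E + equality_cost n V E"
proof -
  have "simple_graph V E" using assms by (simp add: connected_graph_def)
  from equality_protocol_add[OF this]
  show ?thesis using equality_cost_le ex_optimal_equality_protocol[OF assms] by metis
qed

section \<open>Existence of the rate\<close>

text \<open>Fekete's lemma. For \<open>n = q * m + r\<close> with \<open>a m / m\<close> close to
  the infimum, \<open>a n\<close> is at most \<open>q * a m + a r\<close>, and the remainder term
  stays bounded while \<open>n\<close> grows.\<close>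

lemma subadditive_imp_convergent:
  fixes a :: "nat \<Rightarrow> real"
  assumes sub: "\<And>m n. a (m + n) \<le> a m + a n" and nonneg: "\<And>n. 0 \<le> a n"
  shows "convergent (\<lambda>n. a n / real n)"
proof -
  define L where "L = (INF n\<in>{1..}. a n / real n)"
  have bdd: "bdd_below ((\<lambda>n. a n / real n) ` {1..})"
    using nonneg by (intro bdd_belowI[of _ 0]) auto
  have mult: "a (q * m + r) \<le> real q * a m + a r" for q m r
  proof (induction q)
    case (Suc q)
    have "a (Suc q * m + r) \<le> a m + a (q * m + r)"
      using sub[of m "q * m + r"] by (simp add: add.assoc)
    then show ?case using Suc by (simp add: algebra_simps)
  qed simp
  have "(\<lambda>n. a n / real n) \<longlonglongrightarrow> L"
  proof (rule LIMSEQ_I)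
    fix e :: real assume e: "0 < e"
    have "\<exists>m\<in>{1..}. a m / real m < L + e / 2"
      using cINF_less_iff[OF _ bdd, of "L + e / 2"] e unfolding L_def by auto
    then obtain m where m: "m \<ge> 1" "a m / real m < L + e / 2" by auto
    \<comment> \<open>By nonnegativity the sum bounds every \<open>a r\<close> with
      \<open>r < m\<close>; then \<open>N\<close> is taken so large that
      \<open>K / n < e / 2\<close> for \<open>n > N\<close>.\<close>
    define K where "K = (\<Sum>r<m. a r)"
    obtain N where N: "2 * K / e < real N" using reals_Archimedean2 by blast
    have "norm (a n / real n - L) < e" if n: "n \<ge> Suc N" for n
    proof -
      have n0: "0 < n" using n by simp
      have "L \<le> a n / real n"
        unfolding L_def using bdd n0 by (intro cINF_lower) auto
      moreover have "a (n mod m) \<le> K"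
        unfolding K_def using m(1) nonneg by (intro member_le_sum) auto
      then have "a n \<le> real (n div m) * a m + K"
        using mult[of "n div m" m "n mod m"] by simp
      moreover have "real (n div m) * a m \<le> real n * (a m / real m)"
      proof -
        have "real (n div m) \<le> real n / real m" by (rule of_nat_div_le_of_nat)
        from mult_right_mono[OF this nonneg[of m]] show ?thesis by simp
      qed
      moreover have "K < e / 2 * real n"
      proof -
        have "2 * K / e < real n" using N n by linarith
        then show ?thesis using e by (simp add: field_simps)
      qed
      moreover have "real n * (a m / real m) < real n * (L + e / 2)"
        using m(2) n0 by (intro mult_strict_left_mono) auto
      ultimately have "a n < real n * (L + e)" "L \<le> a n / real n"
        by (auto simp: algebra_simps)
      then have "a n / real n < L + e" using n0 by (simp add: field_simps)
      then show ?thesis using \<open>L \<le> a n / real n\<close> by simp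
    qed
    then show "\<exists>no. \<forall>n\<ge>no. norm (a n / real n - L) < e" by blast
  qed
  then show ?thesis by (rule convergentI)
qed

lemma equality_rate_LIMSEQ:
  assumes "connected_graph V E"
  shows "(\<lambda>n. real (equality_cost n V E) / real n) \<longlonglongrightarrow> equality_rate V E"
proof -
  have "real (equality_cost (m + n) V E) \<le> real (equality_cost m V E) + real (equality_cost n V E)" for m n
    using equality_cost_subadditive[OF assms, of m n] by linarith
  then have "convergent (\<lambda>n. real (equality_cost n V E) / real n)"
    by (intro subadditive_imp_convergent) auto
  then show ?thesis unfolding equality_rate_def by (simp add: convergent_LIMSEQ_iff)
qed

section \<open>Transcripts across a cut\<close>

text \<open>\<open>F\<close> is not assumed reachable, only locally consistent: each history obeys
  its program, ends in a decision, and receives only what was sent. Determinism then keeps every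
  real run inside \<open>F\<close>.\<close>

lemma reachable_prefix:
  assumes follows: "\<And>v p e q. v \<in> V \<Longrightarrow> F v = p @ e # q \<Longrightarrow> follows E v (P v (x v) p) e"
    and decided: "\<And>v. v \<in> V \<Longrightarrow> P v (x v) (F v) = Decide (d v)"
    and channels: "\<And>v w. v \<in> V \<Longrightarrow> w \<in> V \<Longrightarrow> prefix (received_from w (F v)) (sent_to v (F w))"
    and G: "simple_graph V E" and H: "H \<in> reachable V E P x"
  shows "v \<in> V \<Longrightarrow> prefix (H v) (F v)"
  using H
proof (induction arbitrary: v rule: reachable_induct)
  case (step H u e)
  show ?case
  proof (cases "v = u")
    case True
    have u: "u \<in> V" and e: "follows E u (P u (x u) (H u)) e" "available H u e"
      using step.hyps(2) by (auto simp: enabled_def)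
    obtain h where h: "F u = H u @ h" using step.IH[OF u] by (auto simp: prefix_def)
    \<comment> \<open>The program prescribes an event at \<open>H u\<close> but a decision at
      \<open>F u\<close>, so the two differ.\<close>
    have "h \<noteq> []" using e(1) decided[OF u] h by (cases e) auto
    then obtain e' q where q: "F u = H u @ e' # q" using h by (cases h) auto
    have e': "follows E u (P u (x u) (H u)) e'" using follows[OF u q] .
    have "e' = e"
    proof (cases e)
      case (Sent w b)
      then show ?thesis using e(1) e' by (cases e') auto
    next
      case (Received w b)
      then obtain b' where b': "e' = Received w b'" using e(1) e' by (cases e') auto
      have w: "w \<in> V" using e(1) Received simple_graph_edge(2)[OF G, of u w] by simp
      obtain bs where bs: "sent_to u (H w) = received_from w (H u) @ b # bs"
        using e(2) Received by auto
      \<comment> \<open>Both \<open>b'\<close> and \<open>b\<close> are the next bit in the stream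
        from \<open>w\<close> to \<open>u\<close>, because \<open>H w\<close> is a prefix of
        \<open>F w\<close>.\<close>
      have "prefix (received_from w (H u) @ [b']) (sent_to u (F w))"
        using channels[OF u w] q b' by (auto simp: prefix_def)
      moreover have "prefix (received_from w (H u) @ [b]) (sent_to u (F w))"
        using prefix_sent_to[OF step.IH[OF w], of u] bs by (auto simp: prefix_def)
      ultimately show ?thesis using b' Received by (auto simp: prefix_def)
    qed
    then show ?thesis using True q by (simp add: prefix_def)
  next
    case False
    then show ?thesis using step.IH[OF step.prems] by simp
  qed
qed simp

text \<open>The pairs are ordered because each edge has a channel in each direction. Pairs that are
  not edges contribute nothing, since no bit is ever sent along them.\<close>

definition crossing :: "'a set \<Rightarrow> 'a set \<Rightarrow> ('a \<times> 'a) set" where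
  "crossing V S = {(u, w) \<in> V \<times> V. u \<in> S \<longleftrightarrow> w \<notin> S}"

text \<open>Cut and paste: if the diagonal inputs \<open>s\<close> and \<open>s'\<close> led to the same transcript across the
  cut, then the input with \<open>s\<close> on \<open>S\<close> and \<open>s'\<close> elsewhere would look to every player like one of
  the two, and would be accepted.\<close>

lemma cut_fooling:
  assumes G: "simple_graph V E" and P: "equality_protocol n V E c P"
    and S: "S \<subset> V" "S \<noteq> {}" and len: "length s = n" "length s' = n"
    and F: "completes V E P (\<lambda>_. s) F (\<lambda>_. True)"
    and F': "completes V E P (\<lambda>_. s') F' (\<lambda>_. True)"
    and eq: "\<And>u w. (u, w) \<in> crossing V S \<Longrightarrow> sent_to w (F u) = sent_to w (F' u)"
  shows "s = s'"
proof -
  define x where "x v = (if v \<in> S then s else s')" for v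
  define M where "M v = (if v \<in> S then F v else F' v)" for v
  have "x \<in> inputs V n" using len by (simp add: inputs_def x_def)
  then obtain H where H: "completes V E P x H (\<lambda>_. all_equal V x)"
    using P by (auto simp: equality_protocol_def)
  have FF: "F \<in> reachable V E P (\<lambda>_. s)" "F' \<in> reachable V E P (\<lambda>_. s')"
    using F F' by (auto simp: completes_def)
  have follows: "follows E v (P v (x v) p) e" if "M v = p @ e # q" for v p e q
    using that reachable_follows[OF FF(1)] reachable_follows[OF FF(2)]
    by (auto simp: M_def x_def split: if_splits)
  have decided: "P v (x v) (M v) = Decide True" if "v \<in> V" for v
    using F F' that by (simp add: M_def x_def completes_def)
  \<comment> \<open>Inside one side the channels match within a single run; across the cut
    \<open>eq\<close> exchanges the senders of the two runs.\<close>
  have "received_from w (M v) = sent_to v (M w)" if "v \<in> V" "w \<in> V" for v w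
    using F F' that eq[of w v] by (auto simp: M_def completes_def crossing_def)
  then have channels: "prefix (received_from w (M v)) (sent_to v (M w))"
    if "v \<in> V" "w \<in> V" for v w using that by simp
  have "H \<in> reachable V E P x" using H by (simp add: completes_def)
  then have "prefix (H v) (M v)" if "v \<in> V" for v
    by (rule reachable_prefix[where F = M and P = P and x = x and d = "\<lambda>_. True",
      rotated 4, OF _ that follows decided channels G])
  moreover obtain v where v: "v \<in> S" "v \<in> V" using S by blast
  ultimately obtain h where h: "M v = H v @ h" by (auto simp: prefix_def)
  \<comment> \<open>The real run on \<open>x\<close> stops at \<open>H v\<close> with a decision,
    whereas a longer \<open>M v\<close> would show an event there. So \<open>v\<close> ends exactly
    as in the pasted configuration and accepts.\<close>
  have "h = []"
  proof (rule ccontr)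
    assume "h \<noteq> []"
    then obtain e q where "M v = H v @ e # q" using h by (cases h) auto
    from follows[OF this] show False using H v by (cases e) (auto simp: completes_def)
  qed
  then have "all_equal V x" using decided[OF v(2)] H v h by (simp add: completes_def)
  moreover obtain w where "w \<in> V" "w \<notin> S" using S by blast
  ultimately have "x v = x w" using v(2) unfolding all_equal_def by blast
  then show ?thesis using v(1) \<open>w \<notin> S\<close> by (simp add: x_def)
qed

section \<open>Counting short transcripts\<close>

lemma card_bool_lists: "card {l :: bool list. length l = j} = 2 ^ j"
  using card_lists_length_eq[of "UNIV :: bool set" j] by simp

lemma finite_bool_lists_le: "finite {l :: bool list. length l \<le> k}"
  using finite_lists_length_le[of "UNIV :: bool set" k] by simp

lemma bounded_families_subset:
  assumes "finite D"
  shows "{t \<in> D \<rightarrow>\<^sub>E (UNIV :: bool list set). (\<Sum>d\<in>D. length (t d)) \<le> k}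
    \<subseteq> (D \<rightarrow>\<^sub>E {l. length l \<le> k})"
proof
  fix t assume t: "t \<in> {t \<in> D \<rightarrow>\<^sub>E (UNIV :: bool list set). (\<Sum>d\<in>D. length (t d)) \<le> k}"
  have "length (t d) \<le> k" if "d \<in> D" for d
    using member_le_sum[of d D "\<lambda>d. length (t d)"] that assms t by simp
  then show "t \<in> (D \<rightarrow>\<^sub>E {l. length l \<le> k})" using t by (auto simp: PiE_iff)
qed

text \<open>Weighting each family by \<open>2\<^sup>-\<^sup>l\<close>, \<open>l\<close> its total length, turns the count into a product.\<close>

lemma card_bounded_families:
  assumes D: "finite D"
  shows "card {t \<in> D \<rightarrow>\<^sub>E (UNIV :: bool list set). (\<Sum>d\<in>D. length (t d)) \<le> k} \<le> (k + 1) ^ card D * 2 ^ k"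
    (is "card ?A \<le> _")
proof -
  let ?L = "{l :: bool list. length l \<le> k}"
  let ?w = "\<lambda>l :: bool list. (1 / 2 :: real) ^ length l"
  note sub = bounded_families_subset[OF D]
  note fin = finite_PiE[OF D finite_bool_lists_le]
  have "(\<Sum>l\<in>?L. ?w l) = (\<Sum>j\<le>k. \<Sum>l\<in>{l \<in> ?L. length l = j}. ?w l)"
    using finite_bool_lists_le by (intro sum.group[symmetric]) auto
  \<comment> \<open>There are \<open>2 ^ j\<close> lists of length \<open>j\<close>, each of weight
    \<open>(1 / 2) ^ j\<close>.\<close>
  also have "\<dots> = (\<Sum>j\<le>k. 1)"
  proof (intro sum.cong refl)
    fix j assume "j \<in> {..k}"
    then have "{l \<in> ?L. length l = j} = {l. length l = j}" by auto
    then show "(\<Sum>l\<in>{l \<in> ?L. length l = j}. ?w l) = 1"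
      by (simp add: card_bool_lists power_one_over)
  qed
  finally have L: "(\<Sum>l\<in>?L. ?w l) = real (k + 1)" by simp
  have "real (card ?A) * (1 / 2) ^ k = (\<Sum>t\<in>?A. (1 / 2) ^ k)" by simp
  \<comment> \<open>A family of total length at most \<open>k\<close> has weight at least
    \<open>(1 / 2) ^ k\<close>.\<close>
  also have "\<dots> \<le> (\<Sum>t\<in>?A. \<Prod>d\<in>D. ?w (t d))"
    by (intro sum_mono) (auto simp: power_sum[symmetric] intro!: power_decreasing)
  also have "\<dots> \<le> (\<Sum>t\<in>D \<rightarrow>\<^sub>E ?L. \<Prod>d\<in>D. ?w (t d))"
    using sub fin by (intro sum_mono2 prod_nonneg) auto
  also have "\<dots> = (\<Prod>d\<in>D. \<Sum>l\<in>?L. ?w l)"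
    using D finite_bool_lists_le by (intro prod_sum_PiE[symmetric]) auto
  also have "\<dots> = real ((k + 1) ^ card D)" unfolding L by simp
  finally have "real (card ?A) \<le> real ((k + 1) ^ card D) * 2 ^ k"
    by (simp add: field_simps power_one_over)
  then have "real (card ?A) \<le> real ((k + 1) ^ card D * 2 ^ k)" by simp
  then show ?thesis by (simp only: of_nat_le_iff)
qed

text \<open>Cut and paste makes the transcript across the cut an injective function of
  \<open>s\<close>, so it suffices to count transcripts. The exponent
  \<open>card (V \<times> V)\<close> makes the bound uniform in \<open>S\<close>.\<close>

lemma card_short_transcripts:
  assumes G: "simple_graph V E" and P: "equality_protocol n V E c P"
    and S: "S \<subset> V" "S \<noteq> {}"
    and F: "\<And>s. length s = n \<Longrightarrow> completes V E P (\<lambda>_. s) (F s) (\<lambda>_. True)"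
  shows "card {s. length s = n \<and> (\<Sum>(u, w)\<in>crossing V S. length (sent_to w (F s u))) \<le> k}
    \<le> (k + 1) ^ card (V \<times> V) * 2 ^ k" (is "card ?B \<le> _")
proof -
  have fV: "finite (V \<times> V)" using G by (simp add: simple_graph_def)
  have sub: "crossing V S \<subseteq> V \<times> V" by (auto simp: crossing_def)
  have fin: "finite (crossing V S)" using finite_subset[OF sub fV] .
  let ?t = "\<lambda>s. restrict (\<lambda>(u, w). sent_to w (F s u)) (crossing V S)"
  let ?A = "{t \<in> crossing V S \<rightarrow>\<^sub>E (UNIV :: bool list set). (\<Sum>d\<in>crossing V S. length (t d)) \<le> k}"
  have inj: "inj_on ?t ?B"
  proof (rule inj_onI)
    fix s s' assume s: "s \<in> ?B" "s' \<in> ?B" and eq: "?t s = ?t s'"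
    have "sent_to w (F s u) = sent_to w (F s' u)" if "(u, w) \<in> crossing V S" for u w
      using fun_cong[OF eq, of "(u, w)"] that by simp
    then show "s = s'" using cut_fooling[OF G P S _ _ F F] s by simp
  qed
  have "?t ` ?B \<subseteq> ?A" by (auto simp: split_def)
  moreover have "finite ?A"
    by (rule finite_subset[OF bounded_families_subset[OF fin] finite_PiE[OF fin finite_bool_lists_le]])
  ultimately have "card ?B \<le> card ?A" using inj by (intro card_inj_on_le)
  also have "\<dots> \<le> (k + 1) ^ card (crossing V S) * 2 ^ k" using card_bounded_families[OF fin] .
  also have "\<dots> \<le> (k + 1) ^ card (V \<times> V) * 2 ^ k"
    using card_mono[OF fV sub] by (intro mult_right_mono power_increasing) auto
  finally show ?thesis .
qed

section \<open>Packing cuts\<close>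

lemma finite_graph_cuts: "finite V \<Longrightarrow> finite (graph_cuts V)"
  by (rule finite_subset[of _ "(\<lambda>S. {S, V - S}) ` Pow V"]) (auto simp: graph_cuts_def)

text \<open>This passes from the unordered cut to a chosen side \<open>S\<close>: naming the other
  side or reversing the edge describes the same crossing.\<close>

lemma mem_cuts_containing_iff:
  assumes "S \<noteq> {}" "S \<subset> V"
  shows "u \<in> V \<and> w \<in> V \<and> {S, V - S} \<in> cuts_containing V {u, w} \<longleftrightarrow> (u, w) \<in> crossing V S"
proof -
  have cut: "{S, V - S} \<in> graph_cuts V" using assms unfolding graph_cuts_def by blast
  have cross: "(\<exists>S' a b. {S, V - S} = {S', V - S'} \<and> {u, w} = {a, b} \<and> a \<in> S' \<and> b \<in> V - S')
      \<longleftrightarrow> (u \<in> S \<longleftrightarrow> w \<notin> S)" (is "?L \<longleftrightarrow> ?R") if uw: "u \<in> V" "w \<in> V"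
  proof
    assume ?L
    then show ?R
    proof (elim exE conjE)
      fix S' a b
      assume *: "{S, V - S} = {S', V - S'}" "{u, w} = {a, b}" "a \<in> S'" "b \<in> V - S'"
      have "S = S' \<or> S = V - S'" using doubleton_eq_iff[THEN iffD1, OF *(1)] by blast
      moreover have "u = a \<and> w = b \<or> u = b \<and> w = a"
        using doubleton_eq_iff[THEN iffD1, OF *(2)] by blast
      ultimately show ?R using *(3,4) uw by auto
    qed
  next
    assume R: ?R
    show ?L
    proof (cases "u \<in> S")
      case True
      then show ?thesis using R uw
        by (intro exI[of _ S] exI[of _ u] exI[of _ w]) simp
    next
      case False
      then show ?thesis using R uw
        by (intro exI[of _ S] exI[of _ w] exI[of _ u]) (simp add: doubleton_eq_iff)
    qed
  qed
  show ?thesis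
  proof (cases "u \<in> V \<and> w \<in> V")
    case True
    then show ?thesis using cut cross
      by (simp only: cuts_containing_def crossing_def mem_Collect_eq prod.case mem_Sigma_iff simp_thms)
  next
    case False
    then show ?thesis by (auto simp: crossing_def)
  qed
qed

text \<open>The hypothesis on \<open>k\<close> is the union bound: the strings that send at most
  \<open>k\<close> bits across some cut do not exhaust all \<open>2 ^ n\<close>. For a remaining
  string, weighted double counting over cuts and channels gives the estimate.\<close>

lemma fractional_cut_packing_le_cost:
  assumes con: "connected_graph V E" and g: "fractional_cut_packing V E g"
    and k: "card (graph_cuts V) * ((k + 1) ^ card (V \<times> V) * 2 ^ k) < 2 ^ n"
  shows "real k * (\<Sum>C\<in>graph_cuts V. g C) \<le> real (equality_cost n V E)"
proof -
  have G: "simple_graph V E" using con by (simp add: connected_graph_def)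
  have fin: "finite V" using G by (simp add: simple_graph_def)
  obtain P where P: "equality_protocol n V E (equality_cost n V E) P"
    using ex_optimal_equality_protocol[OF con] by blast
  have "\<exists>F. completes V E P (\<lambda>_. s) F (\<lambda>_. True) \<and> bits_sent V F \<le> equality_cost n V E"
    if "length s = n" for s
  proof -
    have "(\<lambda>_. s) \<in> inputs V n" using that by (simp add: inputs_def)
    from bspec[OF P[unfolded equality_protocol_def] this] show ?thesis by (simp add: all_equal_def)
  qed
  then obtain F where F: "\<And>s. length s = n \<Longrightarrow> completes V E P (\<lambda>_. s) (F s) (\<lambda>_. True)"
    "\<And>s. length s = n \<Longrightarrow> bits_sent V (F s) \<le> equality_cost n V E" by metis
  \<comment> \<open>This is \<open>crossing\<close> for an unordered cut, written as a relation
    between pairs and cuts so that the two summations can be exchanged.\<close>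
  define across where "across C = {p \<in> V \<times> V. C \<in> cuts_containing V {fst p, snd p}}" for C
  define len where "len s p = length (sent_to (snd p) (F s (fst p)))" for s and p :: "'a \<times> 'a"
  define bad where "bad C = {s. length s = n \<and> (\<Sum>p\<in>across C. len s p) \<le> k}" for C
  have bad: "card (bad C) \<le> (k + 1) ^ card (V \<times> V) * 2 ^ k" if "C \<in> graph_cuts V" for C
  proof -
    have "\<exists>S. C = {S, V - S} \<and> S \<noteq> {} \<and> S \<subset> V"
      using that unfolding graph_cuts_def by (rule CollectD)
    then obtain S where S: "S \<subset> V" "S \<noteq> {}" "C = {S, V - S}" by metis
    then have "across C = crossing V S"
      using mem_cuts_containing_iff[OF S(2,1)] unfolding across_def by force
    then show ?thesis using card_short_transcripts[OF G P S(1,2) F(1), of k]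
      unfolding bad_def len_def by (simp add: split_def)
  qed
  have finB: "finite {s :: bool list. length s = n}"
    using finite_lists_length_eq[of "UNIV :: bool set" n] by simp
  have "card (\<Union>C\<in>graph_cuts V. bad C) \<le> (\<Sum>C\<in>graph_cuts V. card (bad C))"
    using finite_graph_cuts[OF fin] by (rule card_UN_le)
  also have "\<dots> \<le> card (graph_cuts V) * ((k + 1) ^ card (V \<times> V) * 2 ^ k)"
    using sum_bounded_above[OF bad] by simp
  also have "\<dots> < card {s :: bool list. length s = n}" using k by (simp only: card_bool_lists)
  finally have "\<not> {s. length s = n} \<subseteq> (\<Union>C\<in>graph_cuts V. bad C)"
    using card_mono[of "\<Union>C\<in>graph_cuts V. bad C" "{s. length s = n}"]
      finite_subset[of "\<Union>C\<in>graph_cuts V. bad C" "{s. length s = n}"] finB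
    by (force simp: bad_def)
  then obtain s where s: "length s = n" "\<And>C. C \<in> graph_cuts V \<Longrightarrow> k < (\<Sum>p\<in>across C. len s p)"
    unfolding bad_def by force
  have g0: "0 \<le> g C" if "C \<in> graph_cuts V" for C
    using g that by (simp add: fractional_cut_packing_def)
  have cc: "cuts_containing V e = {C \<in> graph_cuts V. C \<in> cuts_containing V e}" for e
    by (auto simp: cuts_containing_def)
  have reach: "F s \<in> reachable V E P (\<lambda>_. s)" using F(1)[OF s(1)] by (simp add: completes_def)
  \<comment> \<open>The packing constraint covers edges only; between vertices that are not adjacent
    nothing is sent and both sides vanish.\<close>
  have edge: "real (len s p) * (\<Sum>C\<in>cuts_containing V {fst p, snd p}. g C) \<le> real (len s p)"
    if "p \<in> V \<times> V" for p
  proof (cases "{fst p, snd p} \<in> E")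
    case True
    then have "(\<Sum>C\<in>cuts_containing V {fst p, snd p}. g C) \<le> 1"
      using g by (simp add: fractional_cut_packing_def)
    then show ?thesis by (simp add: mult_left_le)
  next
    case False
    have "sent_to (snd p) (F s (fst p)) = []"
    proof (rule ccontr)
      assume "sent_to (snd p) (F s (fst p)) \<noteq> []"
      from sent_to_nonempty[OF this] obtain b where "Sent (snd p) b \<in> set (F s (fst p))" ..
      from reachable_event_in_graph[OF reach this] show False using False by simp
    qed
    then show ?thesis by (simp add: len_def)
  qed
  have "real k * (\<Sum>C\<in>graph_cuts V. g C) = (\<Sum>C\<in>graph_cuts V. g C * real k)"
    by (simp add: sum_distrib_left mult.commute)
  also have "\<dots> \<le> (\<Sum>C\<in>graph_cuts V. g C * (\<Sum>p\<in>across C. real (len s p)))"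
  proof (intro sum_mono mult_left_mono g0)
    fix C assume "C \<in> graph_cuts V"
    then have "real k \<le> real (\<Sum>p\<in>across C. len s p)"
      by (intro of_nat_mono less_imp_le s(2))
    then show "real k \<le> (\<Sum>p\<in>across C. real (len s p))" by simp
  qed
  also have "\<dots> = (\<Sum>C\<in>graph_cuts V. \<Sum>p | p \<in> V \<times> V \<and> C \<in> cuts_containing V {fst p, snd p}.
      real (len s p) * g C)"
    unfolding across_def by (simp add: sum_distrib_left mult.commute)
  \<comment> \<open>Double counting: the sum now runs over channels first, so each channel is
    weighted by the total weight of the cuts containing it.\<close>
  also have "\<dots> = (\<Sum>p\<in>V \<times> V. \<Sum>C | C \<in> graph_cuts V \<and> C \<in> cuts_containing V {fst p, snd p}.
      real (len s p) * g C)"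
    using finite_graph_cuts[OF fin] fin by (intro sum.swap_restrict) auto
  also have "\<dots> = (\<Sum>p\<in>V \<times> V. real (len s p) * (\<Sum>C\<in>cuts_containing V {fst p, snd p}. g C))"
    by (simp only: cc[symmetric] sum_distrib_left)
  also have "\<dots> \<le> (\<Sum>p\<in>V \<times> V. real (len s p))" by (intro sum_mono edge)
  also have "\<dots> = real (bits_sent V (F s))"
    unfolding bits_sent_eq_sum[OF G reach] len_def by (simp add: sum.cartesian_product split_def)
  also have "\<dots> \<le> real (equality_cost n V E)" using F(2)[OF s(1)] by simp
  finally show ?thesis .
qed

text \<open>The slack \<open>\<lceil>sqrt (real n)\<rceil>\<close> is large enough that
  \<open>2\<close> to this power eventually beats the polynomial factor, and small enough to
  disappear after division by \<open>n\<close>.\<close>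

lemma eventually_union_bound:
  "\<forall>\<^sub>F n in sequentially. N * ((n - nat \<lceil>sqrt (real n)\<rceil> + 1) ^ M * 2 ^ (n - nat \<lceil>sqrt (real n)\<rceil>)) < (2::nat) ^ n"
proof -
  have "(\<lambda>n. real N * (real n + 1) ^ M / 2 powr sqrt (real n)) \<longlonglongrightarrow> 0" by real_asymp
  then have "\<forall>\<^sub>F n in sequentially. real N * (real n + 1) ^ M / 2 powr sqrt (real n) < 1"
    by (rule order_tendstoD) simp
  \<comment> \<open>This makes the truncated subtraction exact, so that the two powers of
    \<open>2\<close> multiply to \<open>2 ^ n\<close> at the end.\<close>
  moreover have "\<forall>\<^sub>F n in sequentially. nat \<lceil>sqrt (real n)\<rceil> \<le> n"
  proof -
    have "\<lceil>sqrt (real n)\<rceil> \<le> int n" for n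
    proof -
      have "sqrt (real n) \<le> real n"
        by (cases "n = 0") (auto intro!: real_le_lsqrt simp: power2_eq_square)
      then show ?thesis by (simp add: ceiling_le_iff)
    qed
    then show ?thesis by (simp add: nat_le_iff)
  qed
  ultimately show ?thesis
  proof eventually_elim
    case (elim n)
    let ?q = "nat \<lceil>sqrt (real n)\<rceil>"
    have "2 powr sqrt (real n) \<le> 2 powr real ?q" by (intro powr_mono) (auto simp: real_nat_ceiling_ge)
    also have "\<dots> = 2 ^ ?q" by (rule powr_realpow) simp
    finally have "real N * (real n + 1) ^ M < 2 ^ ?q" using elim(1) by (simp add: divide_simps)
    then have "real (N * (n + 1) ^ M) < real (2 ^ ?q)" by (simp add: add.commute)
    then have lt: "N * (n + 1) ^ M < 2 ^ ?q" by (rule of_nat_less_imp_less)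
    have "N * ((n - ?q + 1) ^ M * 2 ^ (n - ?q)) \<le> N * (n + 1) ^ M * 2 ^ (n - ?q)"
      unfolding mult.assoc by (intro mult_left_mono mult_right_mono power_mono) auto
    also have "\<dots> < 2 ^ ?q * 2 ^ (n - ?q)" using lt by simp
    also have "\<dots> = 2 ^ n" using elim(2) by (simp flip: power_add)
    finally show ?case .
  qed
qed

theorem theorem2p3:
  fixes V :: "'a set" and E :: "'a set set"
  assumes "connected_graph V E"
  shows "equality_rate V E \<ge> fc V E"
proof -
  let ?k = "\<lambda>n. n - nat \<lceil>sqrt (real n)\<rceil>"
  have "(\<Sum>C\<in>graph_cuts V. g C) \<le> equality_rate V E" (is "?g \<le> _")
    if g: "fractional_cut_packing V E g" for g
  proof (rule LIMSEQ_le[OF _ equality_rate_LIMSEQ[OF assms]])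
    \<comment> \<open>This factor bounds \<open>?k n / n\<close> from below, the ceiling costing at
      most one more than the square root.\<close>
    have "(\<lambda>n. 1 - (sqrt (real n) + 1) / real n) \<longlonglongrightarrow> 1" by real_asymp
    from tendsto_mult[OF this tendsto_const[of ?g]]
    show "(\<lambda>n. (1 - (sqrt (real n) + 1) / real n) * ?g) \<longlonglongrightarrow> ?g" by simp
    have g0: "0 \<le> ?g" using g by (intro sum_nonneg) (simp add: fractional_cut_packing_def)
    have "\<forall>\<^sub>F n in sequentially.
        (1 - (sqrt (real n) + 1) / real n) * ?g \<le> real (equality_cost n V E) / real n"
      using eventually_union_bound[of "card (graph_cuts V)" "card (V \<times> V)"] eventually_gt_at_top[of 0]
    proof eventually_elim
      case (elim n)
      have "real (nat \<lceil>sqrt (real n)\<rceil>) \<le> sqrt (real n) + 1" by simp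
      then have "real n - (sqrt (real n) + 1) \<le> real (?k n)" by linarith
      then have "(real n - (sqrt (real n) + 1)) * ?g \<le> real (?k n) * ?g"
        using g0 by (rule mult_right_mono)
      also have "\<dots> \<le> real (equality_cost n V E)"
        using fractional_cut_packing_le_cost[OF assms g elim(1)] .
      finally have "(real n - (sqrt (real n) + 1)) * ?g / real n \<le> real (equality_cost n V E) / real n"
        by (rule divide_right_mono) simp
      moreover have "(1 - (sqrt (real n) + 1) / real n) * ?g
          = (real n - (sqrt (real n) + 1)) * ?g / real n"
        using elim(2) by (simp add: field_simps)
      ultimately show ?case by simp
    qed
    then show "\<exists>N. \<forall>n\<ge>N. (1 - (sqrt (real n) + 1) / real n) * ?g \<le> real (equality_cost n V E) / real n"
      by (simp add: eventually_sequentially)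
  qed
  \<comment> \<open>The zero packing shows that the supremum is over a nonempty set, so an upper
    bound on the set bounds \<open>fc V E\<close>.\<close>
  moreover have "fractional_cut_packing V E (\<lambda>_. 0)" by (simp add: fractional_cut_packing_def)
  ultimately show ?thesis unfolding fc_def by (intro cSup_least) blast+
qed

end
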